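(* Let $G=\bigcup_{i=1}^t G_i$ be the disjoint union of graphs $G_1,G_2,\dots,G_t$, and let $a$ be a vertex of $G$ with $a\in V(G_i)$. Then $${}_{G}d_d(a)={}_{G_i}d_d(a)+\sum_{\substack{j=1\\ j\ne i}}^t\gamma(G_j).$$
   Context: Graphs are finite, simple and undirected, with nonempty vertex set. A dominating set of a graph $H$ is a set $D\subseteq V(H)$ such that every vertex in $V(H)\setminus D$ is adjacent to some vertex of $D$. A minimal dominating set is a dominating set that does not properly contain any other dominating set. The domination number $\gamma(H)$ is the minimum cardinality of a dominating set of $H$. The domination degree of a vertex $a$ in $H$ is ${}_{H}d_d(a)=\min\{|D| : D \text{ is a minimal dominating set of } H \text{ with } a\in D\}$. *)

theory Defs
  imports "Graph_Theory.Pair_Digraph" "HOL-Library.Disjoint_Sets"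
begin

text \<open>
  A finite simple undirected graph is a \<^locale>\<open>pair_graph\<close>: a finite vertex set together with
  a symmetric irreflexive relation \<^const>\<open>parcs\<close> on it, so an undirected edge between u and v
  is represented by the two pairs (u, v) and (v, u). The null graph is a \<^locale>\<open>pair_graph\<close>
  too; nonemptiness of the vertex set has to be assumed separately.
\<close>

definition dominating_set :: "'a pair_pre_digraph \<Rightarrow> 'a set \<Rightarrow> bool" where
  "dominating_set H D \<longleftrightarrow>
     D \<subseteq> pverts H \<and> (\<forall>v \<in> pverts H - D. \<exists>u \<in> D. (u, v) \<in> parcs H)"

definition minimal_dominating_set :: "'a pair_pre_digraph \<Rightarrow> 'a set \<Rightarrow> bool" where
  "minimal_dominating_set H D \<longleftrightarrow>
     dominating_set H D \<and> \<not> (\<exists>D'. D' \<subset> D \<and> dominating_set H D')"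

text \<open>
  Both minima below range over finite sets when H is finite. The first is nonempty because the
  whole vertex set is dominating; the second is nonempty for every vertex a of a graph because
  each maximal independent set containing a is a minimal dominating set.
\<close>

definition domination_number :: "'a pair_pre_digraph \<Rightarrow> nat" where
  "domination_number H = Min {card D | D. dominating_set H D}"

definition domination_degree :: "'a pair_pre_digraph \<Rightarrow> 'a \<Rightarrow> nat" where
  "domination_degree H a = Min {card D | D. minimal_dominating_set H D \<and> a \<in> D}"

text \<open>
  The union of a family of graphs over a common vertex type. It is the disjoint union of the
  family whenever the vertex sets are pairwise disjoint.
\<close>

definition graph_Union :: "'i set \<Rightarrow> ('i \<Rightarrow> 'a pair_pre_digraph) \<Rightarrow> 'a pair_pre_digraph" where
  "graph_Union I G =
     \<lparr> pverts = (\<Union>j\<in>I. pverts (G j)), parcs = (\<Union>j\<in>I. parcs (G j)) \<rparr>"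

end

theory Submission
  imports Defs
begin

text \<open>
  The components of a disjoint union do not interact: no edge joins two of them, so a set
  dominates the union iff its trace on every component dominates that component. The same
  holds for minimal dominating sets, because making one trace smaller and leaving the others
  alone makes the whole set smaller, and a set that gets smaller does so in some trace. A minimal
  dominating set of the union through \<open>a\<close> is therefore an independent choice of a minimal
  dominating set of every component, where only the choice in the component of \<open>a\<close> is
  constrained to contain \<open>a\<close>. Cardinalities add up over the components, so the total is
  minimized by minimizing each summand: this gives the domination degree of \<open>a\<close> in its
  own component and, in every other component, the least size of a minimal dominating set. That
  size is the domination number, as a dominating set of least size is minimal.

  The minima must be taken over nonempty sets for this to make sense. For the domination degree
  this is the existence of a minimal dominating set through a given vertex, which a maximal
  independent set containing the vertex provides.
\<close>

section \<open>Dominating sets of a single graph\<close>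

context pair_graph
begin

lemma dominating_set_subset_pverts: "dominating_set G D \<Longrightarrow> D \<subseteq> pverts G"
  by (simp add: dominating_set_def)

lemma finite_card_dominating_sets: "finite {card D | D. dominating_set G D \<and> P D}"
proof -
  have "{card D | D. dominating_set G D \<and> P D} \<subseteq> card ` Pow (pverts G)"
    by (auto dest: dominating_set_subset_pverts)
  then show ?thesis
    by (rule finite_subset) simp
qed

lemma domination_number_le:
  assumes "dominating_set G D"
  shows "domination_number G \<le> card D"
  unfolding domination_number_def
  using finite_card_dominating_sets[of "\<lambda>_. True"] assms by (intro Min_le) auto

text \<open>A proper subset of a finite set is strictly smaller, so least size forces minimality.\<close>

lemma domination_number_attained:
  obtains D where "minimal_dominating_set G D" "card D = domination_number G"
proof -
  have "dominating_set G (pverts G)"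
    by (simp add: dominating_set_def)
  then have "domination_number G \<in> {card D | D. dominating_set G D}"
    unfolding domination_number_def
    using finite_card_dominating_sets[of "\<lambda>_. True"] by (intro Min_in) auto
  then obtain D where D: "dominating_set G D" "card D = domination_number G"
    by auto
  have "finite D"
    using dominating_set_subset_pverts[OF D(1)] pair_finite_verts by (rule finite_subset)
  then have "\<not> dominating_set G D'" if "D' \<subset> D" for D'
    using domination_number_le[of D'] psubset_card_mono[of D D'] that D(2) by auto
  with D show thesis
    by (intro that) (auto simp: minimal_dominating_set_def)
qed

text \<open>
  Take a maximal independent set \<open>S\<close> through \<open>a\<close>. It dominates, since an undominated vertex
  could be added to it. It is minimal, since a vertex of \<open>S\<close> that is left out would have
  no neighbour in \<open>S\<close> to dominate it.
\<close>

lemma ex_minimal_dominating_set_through: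
  assumes "a \<in> pverts G"
  obtains D where "minimal_dominating_set G D" "a \<in> D"
proof -
  define indep where "indep S \<longleftrightarrow> (\<forall>u\<in>S. \<forall>v\<in>S. (u, v) \<notin> parcs G)" for S
  define \<S> where "\<S> = {S. S \<subseteq> pverts G \<and> a \<in> S \<and> indep S}"
  have loopfree: "(v, v) \<notin> parcs G" for v
    using pair_no_loops[of "(v, v)"] by auto
  have "finite \<S>"
    by (rule finite_subset[of _ "Pow (pverts G)"]) (auto simp: \<S>_def)
  moreover have "{a} \<in> \<S>"
    using assms loopfree by (simp add: \<S>_def indep_def)
  ultimately obtain S where S: "S \<in> \<S>" and max: "\<And>T. T \<in> \<S> \<Longrightarrow> S \<subseteq> T \<Longrightarrow> S = T"
    using finite_has_maximal[of \<S>] by blast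
  have indep: "indep S" and sub: "S \<subseteq> pverts G" and "a \<in> S"
    using S by (auto simp: \<S>_def)
  have "\<exists>u\<in>S. (u, v) \<in> parcs G" if v: "v \<in> pverts G - S" for v
  proof (rule ccontr)
    assume "\<not> ?thesis"
    then have "indep (insert v S)"
      using indep loopfree arcs_symmetric by (auto simp: indep_def)
    then have "insert v S \<in> \<S>"
      using v sub \<open>a \<in> S\<close> by (simp add: \<S>_def)
    then show False
      using max[of "insert v S"] v by blast
  qed
  then have dom: "dominating_set G S"
    using sub by (simp add: dominating_set_def)
  have "\<not> dominating_set G D'" if D': "D' \<subset> S" for D'
  proof
    assume "dominating_set G D'"
    moreover obtain v where "v \<in> S" "v \<notin> D'"
      using D' by blast
    ultimately obtain u where "u \<in> D'" "(u, v) \<in> parcs G"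
      using sub by (fastforce simp: dominating_set_def)
    then show False
      using indep D' \<open>v \<in> S\<close> by (auto simp: indep_def)
  qed
  with dom \<open>a \<in> S\<close> show thesis
    by (intro that) (auto simp: minimal_dominating_set_def)
qed

lemma finite_card_minimal_dominating_sets:
  "finite {card D | D. minimal_dominating_set G D \<and> P D}"
  by (rule finite_subset[OF _ finite_card_dominating_sets[of "\<lambda>_. True"]])
    (auto simp: minimal_dominating_set_def)

lemma domination_degree_le:
  assumes "minimal_dominating_set G D" "a \<in> D"
  shows "domination_degree G a \<le> card D"
  unfolding domination_degree_def
  using finite_card_minimal_dominating_sets assms by (intro Min_le) auto

lemma domination_degree_attained:
  assumes "a \<in> pverts G"
  obtains D where "minimal_dominating_set G D" "a \<in> D" "card D = domination_degree G a"
proof -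
  obtain D\<^sub>0 where "minimal_dominating_set G D\<^sub>0" "a \<in> D\<^sub>0"
    using ex_minimal_dominating_set_through[OF assms] .
  then have "domination_degree G a \<in> {card D | D. minimal_dominating_set G D \<and> a \<in> D}"
    unfolding domination_degree_def
    using finite_card_minimal_dominating_sets by (intro Min_in) auto
  then show thesis
    using that by auto
qed

end

section \<open>Disjoint unions\<close>

locale disjoint_graph_family =
  fixes I :: "'i set" and G :: "'i \<Rightarrow> 'a pair_pre_digraph"
  assumes finite_index: "finite I"
    and graph: "j \<in> I \<Longrightarrow> pair_graph (G j)"
    and disjoint: "disjoint_family_on (\<lambda>j. pverts (G j)) I"
begin

lemma pverts_Union [simp]: "pverts (graph_Union I G) = (\<Union>j\<in>I. pverts (G j))"
  by (simp add: graph_Union_def)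

lemma component_unique:
  "j \<in> I \<Longrightarrow> k \<in> I \<Longrightarrow> v \<in> pverts (G j) \<Longrightarrow> v \<in> pverts (G k) \<Longrightarrow> j = k"
  using disjoint by (auto simp: disjoint_family_on_def)

lemma arc_in_component_iff:
  assumes "j \<in> I" "v \<in> pverts (G j)"
  shows "(u, v) \<in> parcs (graph_Union I G) \<longleftrightarrow> u \<in> pverts (G j) \<and> (u, v) \<in> parcs (G j)"
proof -
  have ends: "u \<in> pverts (G k) \<and> v \<in> pverts (G k)" if "k \<in> I" "(u, v) \<in> parcs (G k)" for k
  proof -
    interpret pair_graph "G k"
      using graph that(1) .
    show ?thesis
      using in_arcsD1 in_arcsD2 that(2) by blast
  qed
  then have "k = j" if "k \<in> I" "(u, v) \<in> parcs (G k)" for k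
    using that assms component_unique by blast
  with ends show ?thesis
    using assms(1) by (auto simp: graph_Union_def)
qed

text \<open>
  A vertex of a component has the same neighbours in the union as in the component, so it can
  be dominated only from within its own component.
\<close>

lemma dominating_set_Union_iff:
  "dominating_set (graph_Union I G) D \<longleftrightarrow>
     D \<subseteq> (\<Union>j\<in>I. pverts (G j)) \<and> (\<forall>j\<in>I. dominating_set (G j) (D \<inter> pverts (G j)))"
proof -
  have "(\<exists>u\<in>D. (u, v) \<in> parcs (graph_Union I G)) \<longleftrightarrow>
      (\<exists>u\<in>D \<inter> pverts (G j). (u, v) \<in> parcs (G j))" if "j \<in> I" "v \<in> pverts (G j)" for j v
    using arc_in_component_iff[OF that] by blast
  then show ?thesis
    unfolding dominating_set_def pverts_Union by blast
qed

lemma minimal_dominating_set_Union_iff: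
  "minimal_dominating_set (graph_Union I G) D \<longleftrightarrow>
     D \<subseteq> (\<Union>j\<in>I. pverts (G j)) \<and> (\<forall>j\<in>I. minimal_dominating_set (G j) (D \<inter> pverts (G j)))"
  (is "?L \<longleftrightarrow> ?R")
proof
  assume L: ?L
  then have dom: "dominating_set (graph_Union I G) D"
    and min: "\<And>D'. D' \<subset> D \<Longrightarrow> \<not> dominating_set (graph_Union I G) D'"
    by (auto simp: minimal_dominating_set_def)
  have "\<not> dominating_set (G j) E" if j: "j \<in> I" and E: "E \<subset> D \<inter> pverts (G j)" for j E
  proof
    assume domE: "dominating_set (G j) E"
    \<comment> \<open>Replacing the trace of \<open>D\<close> on the component \<open>j\<close> by \<open>E\<close> leaves all other traces as they are.\<close>
    define D' where "D' = (D - pverts (G j)) \<union> E"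
    have trace: "D' \<inter> pverts (G k) = (if k = j then E else D \<inter> pverts (G k))"
      if "k \<in> I" for k
      using E component_unique[OF j that] by (auto simp: D'_def)
    have "D' \<subset> D"
      using E by (auto simp: D'_def)
    moreover from this have "dominating_set (graph_Union I G) D'"
      using dom domE by (auto simp: dominating_set_Union_iff trace)
    ultimately show False
      using min by blast
  qed
  then show ?R
    using dom by (auto simp: minimal_dominating_set_def dominating_set_Union_iff)
next
  assume R: ?R
  have "\<not> dominating_set (graph_Union I G) D'" if D': "D' \<subset> D" for D'
  proof
    assume domD': "dominating_set (graph_Union I G) D'"
    obtain x j where x: "x \<in> D" "x \<notin> D'" and j: "j \<in> I" "x \<in> pverts (G j)"
      using D' R by blast
    have "D' \<inter> pverts (G j) \<subset> D \<inter> pverts (G j)"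
      using D' x j(2) by blast
    moreover have "dominating_set (G j) (D' \<inter> pverts (G j))"
      using domD' j(1) by (simp add: dominating_set_Union_iff)
    moreover have "minimal_dominating_set (G j) (D \<inter> pverts (G j))"
      using R j(1) by simp
    ultimately show False
      unfolding minimal_dominating_set_def by blast
  qed
  then show ?L
    using R by (auto simp: minimal_dominating_set_def dominating_set_Union_iff)
qed

lemma card_eq_sum_traces:
  assumes "D \<subseteq> (\<Union>j\<in>I. pverts (G j))"
  shows "card D = (\<Sum>j\<in>I. card (D \<inter> pverts (G j)))"
proof -
  have "finite (pverts (G j))" if "j \<in> I" for j
  proof -
    interpret pair_graph "G j"
      using graph that .
    show ?thesis
      by (rule pair_finite_verts)
  qed
  then have "card (\<Union>j\<in>I. D \<inter> pverts (G j)) = (\<Sum>j\<in>I. card (D \<inter> pverts (G j)))"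
    using finite_index component_unique by (intro card_UN_disjoint) blast+
  moreover have "(\<Union>j\<in>I. D \<inter> pverts (G j)) = D"
    using assms by blast
  ultimately show ?thesis
    by simp
qed

lemma pair_graph_Union: "pair_graph (graph_Union I G)"
proof
  have comp: "finite (pverts (G j))" "finite (parcs (G j))"
    "(u, v) \<in> parcs (G j) \<Longrightarrow>
       u \<in> pverts (G j) \<and> v \<in> pverts (G j) \<and> u \<noteq> v \<and> (v, u) \<in> parcs (G j)"
    if "j \<in> I" for j u v
  proof -
    interpret pair_graph "G j"
      using graph that .
    show "finite (pverts (G j))" "finite (parcs (G j))"
      by (rule pair_finite_verts pair_finite_arcs)+
    assume "(u, v) \<in> parcs (G j)"
    then show "u \<in> pverts (G j) \<and> v \<in> pverts (G j) \<and> u \<noteq> v \<and> (v, u) \<in> parcs (G j)"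
      using in_arcsD1 in_arcsD2 pair_no_loops arcs_symmetric by fastforce
  qed
  show "finite (pverts (graph_Union I G))" "finite (parcs (graph_Union I G))"
    using finite_index comp by (auto simp: graph_Union_def)
  show "fst e \<in> pverts (graph_Union I G)" "snd e \<in> pverts (graph_Union I G)" "fst e \<noteq> snd e"
    if "e \<in> parcs (graph_Union I G)" for e
    using that comp(3)[of _ "fst e" "snd e"] by (auto simp: graph_Union_def)
  show "symmetric (with_proj (graph_Union I G))"
    using comp(3) by (auto simp: symmetric_def graph_Union_def intro!: symI)
qed

text \<open>
  The summands can be minimized separately because minimal dominating sets of the components,
  chosen arbitrarily, always combine to one of the union.
\<close>

theorem domination_degree_Union:
  assumes "i \<in> I" "a \<in> pverts (G i)"
  shows "domination_degree (graph_Union I G) a =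
           domination_degree (G i) a + (\<Sum>j\<in>I - {i}. domination_number (G j))"
proof (rule antisym)
  interpret U: pair_graph "graph_Union I G"
    by (rule pair_graph_Union)
  have split_sum: "sum f I = f i + sum f (I - {i})" for f :: "'i \<Rightarrow> nat"
    using finite_index assms(1) by (rule sum.remove)
  define E where "E j D \<longleftrightarrow> minimal_dominating_set (G j) D \<and>
    (if j = i then a \<in> D \<and> card D = domination_degree (G i) a
     else card D = domination_number (G j))" for j D
  have "\<exists>D. E j D" if j: "j \<in> I" for j
  proof (cases "j = i")
    case True
    obtain D where "minimal_dominating_set (G i) D" "a \<in> D" "card D = domination_degree (G i) a"
      using pair_graph.domination_degree_attained[OF graph[OF assms(1)] assms(2)] .
    with True show ?thesis
      by (auto simp: E_def)
  next
    case False
    obtain D where "minimal_dominating_set (G j) D" "card D = domination_number (G j)"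
      using pair_graph.domination_number_attained[OF graph[OF j]] .
    with False show ?thesis
      by (auto simp: E_def)
  qed
  then obtain F where F: "\<And>j. j \<in> I \<Longrightarrow> E j (F j)"
    by metis
  have F_sub: "F j \<subseteq> pverts (G j)" if "j \<in> I" for j
    using F[OF that] by (auto simp: E_def minimal_dominating_set_def dominating_set_def)
  have trace: "(\<Union>k\<in>I. F k) \<inter> pverts (G j) = F j" if "j \<in> I" for j
    using F_sub component_unique[OF that] that by blast
  have sub: "(\<Union>k\<in>I. F k) \<subseteq> (\<Union>k\<in>I. pverts (G k))"
    using F_sub by blast
  have "minimal_dominating_set (graph_Union I G) (\<Union>k\<in>I. F k)"
    using F sub by (simp add: minimal_dominating_set_Union_iff trace E_def)
  moreover have "a \<in> (\<Union>k\<in>I. F k)"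
    using F[OF assms(1)] assms(1) by (auto simp: E_def)
  ultimately have "domination_degree (graph_Union I G) a \<le> card (\<Union>k\<in>I. F k)"
    by (rule U.domination_degree_le)
  also have "\<dots> = (\<Sum>j\<in>I. card (F j))"
    by (simp add: card_eq_sum_traces[OF sub] trace)
  also have "\<dots> = domination_degree (G i) a + (\<Sum>j\<in>I - {i}. domination_number (G j))"
    using F assms(1) by (simp add: split_sum E_def)
  finally show "domination_degree (graph_Union I G) a \<le> \<dots>" .

  obtain D where D: "minimal_dominating_set (graph_Union I G) D" "a \<in> D"
    "card D = domination_degree (graph_Union I G) a"
    using U.domination_degree_attained[of a] assms by auto
  have D_sub: "D \<subseteq> (\<Union>j\<in>I. pverts (G j))"
    and D_min: "\<And>j. j \<in> I \<Longrightarrow> minimal_dominating_set (G j) (D \<inter> pverts (G j))"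
    using D(1) by (auto simp: minimal_dominating_set_Union_iff)
  have "domination_degree (G i) a \<le> card (D \<inter> pverts (G i))"
    using D_min D(2) assms by (intro pair_graph.domination_degree_le graph) auto
  moreover have "domination_number (G j) \<le> card (D \<inter> pverts (G j))" if "j \<in> I - {i}" for j
    using D_min that
    by (intro pair_graph.domination_number_le graph) (auto simp: minimal_dominating_set_def)
  ultimately have "domination_degree (G i) a + (\<Sum>j\<in>I - {i}. domination_number (G j)) \<le>
      (\<Sum>j\<in>I. card (D \<inter> pverts (G j)))"
    unfolding split_sum by (intro add_mono sum_mono)
  then show "domination_degree (G i) a + (\<Sum>j\<in>I - {i}. domination_number (G j)) \<le>
      domination_degree (graph_Union I G) a"
    by (simp add: card_eq_sum_traces[OF D_sub] flip: D(3))
qed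

end

theorem theorem3p24:
  fixes G :: "nat \<Rightarrow> 'a pair_pre_digraph" and t i :: nat and a :: 'a
  assumes "\<And>j. j \<in> {1..t} \<Longrightarrow> pair_graph (G j)"
    and "\<And>j. j \<in> {1..t} \<Longrightarrow> pverts (G j) \<noteq> {}"
    and "disjoint_family_on (\<lambda>j. pverts (G j)) {1..t}"
    and "i \<in> {1..t}"
    and "a \<in> pverts (G i)"
  shows "domination_degree (graph_Union {1..t} G) a =
           domination_degree (G i) a + (\<Sum>j\<in>{1..t} - {i}. domination_number (G j))"
proof -
  interpret disjoint_graph_family "{1..t}" G
    using assms(1,3) by (intro disjoint_graph_family.intro finite_atLeastAtMost)
  show ?thesis
    using assms(4,5) by (rule domination_degree_Union)
qed

end
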